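(* Let $X$ be a mixed graph whose underlying graph $\Gamma(X)$ is bipartite and has a unique perfect matching, let $\alpha$ be a complex number with $|\alpha|=1$, and let $H_\alpha$ be the $\alpha$-hermitian adjacency matrix of $X$ (which is invertible). Then for every vertex $i\in V(X)$, $(H_\alpha^{-1})_{ii}=0$.
   Context: A mixed graph $X$ consists of a finite vertex set $V(X)$, a set $E_0(X)$ of undirected edges (digons) and a set $E_1(X)$ of directed edges (arcs), with no loops and at most one digon or arc between any two distinct vertices. Its underlying graph $\Gamma(X)$ is obtained by forgetting the orientations of the arcs. For a complex number $\alpha$ of modulus $1$, the $\alpha$-hermitian adjacency matrix $H_\alpha(X)=[h_{uv}]$ is defined by $h_{uv}=1$ if $uv\in E_0(X)$, $h_{uv}=\alpha$ if $uv\in E_1(X)$ (arc from $u$ to $v$), $h_{uv}=\overline{\alpha}$ if $vu\in E_1(X)$, and $h_{uv}=0$ otherwise. *)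

theory Defs
  imports "HOL-Analysis.Analysis"
begin

text \<open>
  The vertex set of a mixed graph is the whole of a type \<open>'v\<close>, of class \<open>finite\<close> where
  finiteness matters, so that matrices over the vertices are of type \<open>complex ^ 'v ^ 'v\<close>.
  A digon is the set of its two ends; an arc \<open>(u, v)\<close> leads from \<open>u\<close> to \<open>v\<close>.
\<close>

record 'v mixed_graph =
  digons :: "'v set set"
  arcs :: "('v \<times> 'v) set"

definition is_mixed_graph :: "'v mixed_graph \<Rightarrow> bool" where
  "is_mixed_graph X \<longleftrightarrow>
     (\<forall>e\<in>digons X. card e = 2) \<and>
     (\<forall>(u, v)\<in>arcs X. u \<noteq> v \<and> {u, v} \<notin> digons X \<and> (v, u) \<notin> arcs X)"

definition underlying_edges :: "'v mixed_graph \<Rightarrow> 'v set set" where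
  "underlying_edges X = digons X \<union> {{u, v} | u v. (u, v) \<in> arcs X}"

definition bipartite :: "'v set set \<Rightarrow> bool" where
  "bipartite E \<longleftrightarrow>
     (\<exists>A B. A \<union> B = UNIV \<and> A \<inter> B = {} \<and> (\<forall>e\<in>E. \<exists>a\<in>A. \<exists>b\<in>B. e = {a, b}))"

definition matching :: "'v set set \<Rightarrow> 'v set set \<Rightarrow> bool" where
  "matching E M \<longleftrightarrow> M \<subseteq> E \<and> pairwise disjnt M"

definition perfect_matching :: "'v set set \<Rightarrow> 'v set set \<Rightarrow> bool" where
  "perfect_matching E M \<longleftrightarrow> matching E M \<and> \<Union>M = UNIV"

definition hermitian_adjacency :: "complex \<Rightarrow> 'v::finite mixed_graph \<Rightarrow> complex ^ 'v ^ 'v" where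
  "hermitian_adjacency \<alpha> X =
     (\<chi> u v. if {u, v} \<in> digons X then 1
             else if (u, v) \<in> arcs X then \<alpha>
             else if (v, u) \<in> arcs X then cnj \<alpha>
             else 0)"

end

theory Submission
  imports Defs
begin

text \<open>
  In the Leibniz expansion of the determinant, a nonzero term comes from a permutation along edges.
  Restricted to either colour class, such a permutation is a perfect matching, so it is
  the involution that swaps the ends of each edge of the unique one. Hence exactly one term is
  nonzero. For the diagonal, let \<open>D\<close> be the diagonal matrix that is 1 on one colour class
  and -1 on the other; then \<open>D H D = -H\<close>, so \<open>D H\<^sup>-\<^sup>1 D = -H\<^sup>-\<^sup>1\<close>, and these
  matrices have opposite diagonals although conjugation by \<open>D\<close> fixes diagonals.
\<close>

text \<open>Names the colour classes that \<open>bipartite\<close> hides behind existential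
  quantifiers, so that facts about one class transfer to the other by swapping the
  arguments.\<close>

definition bipartition :: "'v set set \<Rightarrow> 'v set \<Rightarrow> 'v set \<Rightarrow> bool" where
  "bipartition E A B \<longleftrightarrow>
     A \<union> B = UNIV \<and> A \<inter> B = {} \<and> (\<forall>e\<in>E. \<exists>a\<in>A. \<exists>b\<in>B. e = {a, b})"

lemma bipartition_sym:
  assumes "bipartition E A B"
  shows "bipartition E B A"
proof -
  have "\<exists>b\<in>B. \<exists>a\<in>A. e = {b, a}" if "e \<in> E" for e
  proof -
    have "\<exists>a\<in>A. \<exists>b\<in>B. e = {a, b}"
      using assms that by (simp add: bipartition_def)
    then obtain a b where "a \<in> A" "b \<in> B" "e = {a, b}"
      by (elim bexE)
    moreover from this have "e = {b, a}"
      by (simp only: insert_commute)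
    ultimately show ?thesis
      by (intro bexI)
  qed
  then show ?thesis
    using assms by (simp add: bipartition_def Un_commute Int_commute)
qed

lemma bipartition_edge:
  assumes "bipartition E A B" and "{u, v} \<in> E"
  shows "u \<in> A \<longleftrightarrow> v \<in> B" and "u \<in> B \<longleftrightarrow> v \<in> A"
proof -
  have AB: "x \<in> B \<longleftrightarrow> x \<notin> A" for x
    using assms(1) by (auto simp: bipartition_def)
  have "\<exists>a\<in>A. \<exists>b\<in>B. {u, v} = {a, b}"
    using assms by (simp only: bipartition_def)
  then obtain a b where "a \<in> A" "b \<in> B" "{u, v} = {a, b}"
    by (elim bexE)
  then show "u \<in> A \<longleftrightarrow> v \<in> B" and "u \<in> B \<longleftrightarrow> v \<in> A"
    by (auto simp: doubleton_eq_iff AB)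
qed

text \<open>As \<open>p\<close> moves along edges, it switches colour classes. Injectivity then
  makes the edges at distinct vertices of \<open>A\<close> disjoint, and surjectivity covers
  \<open>B\<close>: the preimage of a vertex of \<open>B\<close> lies in \<open>A\<close>.\<close>

lemma perfect_matching_of_permutation:
  assumes bip: "bipartition E A B" and "bij p" and edge: "\<And>i. {i, p i} \<in> E"
  shows "perfect_matching E ((\<lambda>a. {a, p a}) ` A)"
proof -
  have AB: "A \<union> B = UNIV" "A \<inter> B = {}"
    using bip by (auto simp: bipartition_def)
  note cross = bipartition_edge[OF bip edge]
  have "disjnt {a, p a} {a', p a'}" if "a \<in> A" "a' \<in> A" "a \<noteq> a'" for a a'
  proof -
    have "p a \<notin> A" "p a' \<notin> A"
      using that cross(1) AB(2) by blast+
    then show ?thesis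
      using that inj_eq[OF bij_is_inj[OF \<open>bij p\<close>]] by (auto simp: disjnt_def)
  qed
  then have "pairwise disjnt ((\<lambda>a. {a, p a}) ` A)"
    unfolding pairwise_def by blast
  moreover have "\<Union> ((\<lambda>a. {a, p a}) ` A) = UNIV"
  proof -
    have "x \<in> \<Union> ((\<lambda>a. {a, p a}) ` A)" for x
    proof (cases "x \<in> A")
      case False
      obtain y where "x = p y"
        using bij_is_surj[OF \<open>bij p\<close>] by blast
      moreover from this False have "y \<in> A"
        using cross(2)[of y] AB(1) by blast
      ultimately show ?thesis by blast
    qed auto
    then show ?thesis by blast
  qed
  ultimately show ?thesis
    using edge by (auto simp: perfect_matching_def matching_def)
qed

lemma perfect_matching_partner:
  assumes bip: "bipartition E A B" and M: "perfect_matching E M"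
  shows "\<exists>!j. {i, j} \<in> M"
proof -
  have "i \<in> \<Union>M"
    using M by (simp add: perfect_matching_def)
  then obtain e where e: "e \<in> M" "i \<in> e"
    by blast
  then have "e \<in> E"
    using M by (auto simp: perfect_matching_def matching_def)
  then obtain a b where "e = {a, b}"
    using bip by (metis bipartition_def)
  with e(2) obtain j where "e = {i, j}"
    by auto
  moreover have "j = k" if "{i, j} \<in> M" "{i, k} \<in> M" for j k
  proof -
    have "pairwise disjnt M"
      using M by (simp add: perfect_matching_def matching_def)
    moreover have "\<not> disjnt {i, j} {i, k}"
      by (simp add: disjnt_def)
    ultimately have "{i, j} = {i, k}"
      using that by (metis pairwiseD)
    then show ?thesis by (auto simp: doubleton_eq_iff)
  qed
  ultimately show ?thesis
    using e by blast
qed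

lemma unique_edge_permutation:
  assumes bip: "bipartition E A B" and ex1: "\<exists>!M. perfect_matching E M"
  shows "\<exists>!p. bij p \<and> (\<forall>i. {i, p i} \<in> E)"
proof -
  obtain M where M: "perfect_matching E M"
    using ex1 by blast
  have ex1_partner: "\<exists>!j. {i, j} \<in> M" for i
    using perfect_matching_partner[OF bip M] .
  \<comment> \<open>The witness sends each vertex to its partner in \<open>M\<close>; being an
    involution, it is bijective.\<close>
  define m where "m i = (THE j. {i, j} \<in> M)" for i
  have m_edge: "{i, m i} \<in> M" for i
    unfolding m_def by (rule theI'[OF ex1_partner])
  have m_eq: "m i = j" if "{i, j} \<in> M" for i j
    using ex1_partner m_edge that by blast
  have "m (m i) = i" for i
    using m_edge[of i] by (intro m_eq) (simp add: insert_commute)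
  then have "bij m"
    by (rule involuntory_imp_bij)
  moreover have "{i, m i} \<in> E" for i
    using m_edge M by (auto simp: perfect_matching_def matching_def)
  moreover have "p = m" if p: "bij p" "\<forall>i. {i, p i} \<in> E" for p
  proof
    fix i
    \<comment> \<open>The matching built from \<open>A\<close> constrains \<open>p\<close> on
      \<open>A\<close> only; the one built from \<open>B\<close> settles the remaining
      vertices.\<close>
    have "perfect_matching E ((\<lambda>a. {a, p a}) ` A)" "perfect_matching E ((\<lambda>a. {a, p a}) ` B)"
      using perfect_matching_of_permutation[OF _ p(1)] bip bipartition_sym[OF bip] p(2) by auto
    then have "(\<lambda>a. {a, p a}) ` A = M" "(\<lambda>a. {a, p a}) ` B = M"
      using ex1 M by (auto elim: ex1E)
    moreover have "i \<in> A \<or> i \<in> B"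
      using bip by (auto simp: bipartition_def)
    ultimately have "{i, p i} \<in> M"
      by auto
    then show "p i = m i"
      by (simp add: m_eq)
  qed
  ultimately show ?thesis by blast
qed

text \<open>No cancellation can occur: every other Leibniz term has a zero factor, and the surviving
  one is a sign times a product of nonzero entries.\<close>

lemma det_nonzero_if_unique_transversal:
  fixes H :: "'a::field ^ 'n::finite ^ 'n"
  assumes "\<exists>!p. bij p \<and> (\<forall>i. H $ i $ p i \<noteq> 0)"
  shows "det H \<noteq> 0"
proof -
  obtain p where p: "bij p" "\<And>i. H $ i $ p i \<noteq> 0"
    and uniq: "\<And>q. bij q \<Longrightarrow> \<forall>i. H $ i $ q i \<noteq> 0 \<Longrightarrow> q = p"
    using assms by blast
  let ?t = "\<lambda>q. of_int (sign q) * (\<Prod>i\<in>UNIV. H $ i $ q i)"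
  have "det H = sum ?t {p}"
    unfolding det_def
  proof (rule sum.mono_neutral_right)
    show "{p} \<subseteq> {q. q permutes UNIV}"
      using p(1) by (simp add: permutes_univ bij_iff)
    show "\<forall>q\<in>{q. q permutes UNIV} - {p}. ?t q = 0"
      using uniq permutes_bij by auto
  qed (simp add: finite_permutations)
  also have "\<dots> \<noteq> 0"
    using p(2) by (simp add: sign_def)
  finally show ?thesis .
qed

lemma inverse_diagonal_zero_if_bipartite:
  fixes H :: "'a::{field, ring_char_0} ^ 'n::finite ^ 'n"
  assumes inv: "invertible H" and zero: "\<And>u v. (u \<in> A \<longleftrightarrow> v \<in> A) \<Longrightarrow> H $ u $ v = 0"
  shows "matrix_inv H $ i $ i = 0"
proof -
  define K where "K = matrix_inv H"
  have HK: "H ** K = mat 1" and KH: "K ** H = mat 1"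
    using someI_ex[OF inv[unfolded invertible_def]] by (auto simp: K_def matrix_inv_def)
  define s :: "'n \<Rightarrow> 'a" where "s u = (if u \<in> A then 1 else -1)" for u
  \<comment> \<open>With D the diagonal matrix of the signs \<open>s\<close>, this is -DKD. It turns
    out to be another right inverse of \<open>H\<close>, hence equal to \<open>K\<close>.\<close>
  define K' where "K' = (\<chi> u v. - (s u * s v * K $ u $ v))"
  have "(H ** K') $ u $ w = mat 1 $ u $ w" for u w
  proof -
    \<comment> \<open>Within a class both sides vanish; across classes \<open>s v\<close> is the
      negative of \<open>s u\<close>.\<close>
    have "H $ u $ v * - (s v * s w * K $ v $ w) = s u * s w * (H $ u $ v * K $ v $ w)" for v
      using zero[of u v] by (auto simp: s_def)
    then have "(H ** K') $ u $ w = s u * s w * (H ** K) $ u $ w"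
      by (simp add: K'_def matrix_matrix_mult_def sum_distrib_left)
    then show ?thesis
      by (simp add: HK mat_def s_def)
  qed
  then have "H ** K' = mat 1"
    by (simp add: vec_eq_iff)
  then have "K' = K"
    using KH by (metis matrix_mul_assoc matrix_mul_lid matrix_mul_rid)
  moreover have "K' $ i $ i = - (K $ i $ i)"
    by (simp add: K'_def s_def)
  \<comment> \<open>Characteristic 0 allows the factor 2 to be cancelled afterwards.\<close>
  ultimately have "2 * K $ i $ i = 0"
    by (simp only: mult_2 eq_neg_iff_add_eq_0)
  then show ?thesis
    by (simp add: K_def)
qed

text \<open>The link from matrix to graph: both halves of the theorem see the matrix only through
  its pattern of zero and nonzero entries.\<close>

lemma hermitian_adjacency_nonzero_iff:
  assumes "\<alpha> \<noteq> 0"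
  shows "hermitian_adjacency \<alpha> X $ u $ v \<noteq> 0 \<longleftrightarrow> {u, v} \<in> underlying_edges X"
  using assms by (auto simp: hermitian_adjacency_def underlying_edges_def doubleton_eq_iff)

theorem theorem5:
  fixes X :: "'v::finite mixed_graph" and \<alpha> :: complex
  assumes "is_mixed_graph X"
    and "bipartite (underlying_edges X)"
    and "\<exists>!M. perfect_matching (underlying_edges X) M"
    and "cmod \<alpha> = 1"
  shows "invertible (hermitian_adjacency \<alpha> X) \<and>
         (\<forall>i. matrix_inv (hermitian_adjacency \<alpha> X) $ i $ i = 0)"
proof -
  let ?H = "hermitian_adjacency \<alpha> X"
  obtain A B where bip: "bipartition (underlying_edges X) A B"
    using assms(2) unfolding bipartite_def bipartition_def by blast
  have "\<alpha> \<noteq> 0"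
    using assms(4) by auto
  note nonzero_iff = hermitian_adjacency_nonzero_iff[OF this]
  have inv: "invertible ?H"
    using det_nonzero_if_unique_transversal[of ?H] unique_edge_permutation[OF bip assms(3)]
    by (simp add: nonzero_iff invertible_det_nz)
  have "?H $ u $ v = 0" if "u \<in> A \<longleftrightarrow> v \<in> A" for u v
  proof -
    have "v \<in> B \<longleftrightarrow> v \<notin> A"
      using bip by (auto simp: bipartition_def)
    then show ?thesis
      using bipartition_edge(1)[OF bip, of u v] that nonzero_iff[of X u v] by blast
  qed
  then show ?thesis
    using inv inverse_diagonal_zero_if_bipartite by blast
qed

end
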